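(* Let $n$ be a positive integer and let $X = (X_1, \ldots, X_n)$ be an $n$-exchangeable random vector in $\mathbb{R}^n$, where $\mathbb{R}^n$ is endowed with the Borel $\sigma$-algebra. Then there exist a bounded signed measure $\eta(d\theta_1,\ldots,d\theta_n)$ on $\mathbb{R}^n$ and a family $\pi_{\theta_1,\ldots,\theta_n} \in \mathscr{P}(\mathbb{R})$, $(\theta_1,\ldots,\theta_n) \in \mathbb{R}^n$, depending measurably on the $n$ parameters $(\theta_1,\ldots,\theta_n)$, such that, for every Borel set $A \subset \mathbb{R}^n$, $$\mathbb{P}(X \in A) = \int_{\mathbb{R}^n} \pi_{\theta_1,\ldots,\theta_n}^n(A)\, \eta(d\theta_1,\ldots,d\theta_n).$$
   Context: A random vector $X=(X_1,\ldots,X_n)$ in $\mathbb{R}^n$ is $n$-exchangeable if, for every permutation $\sigma$ of $\{1,\ldots,n\}$ and every Borel set $B \subset \mathbb{R}^n$, $\mathbb{P}((X_{\sigma(1)},\ldots,X_{\sigma(n)}) \in B) = \mathbb{P}(X \in B)$. $\mathscr{P}(\mathbb{R})$ denotes the set of Borel probability measures on $\mathbb{R}$, equipped with the $\sigma$-algebra generated by the sets $\{\pi \in \mathscr{P}(\mathbb{R}) : \pi(B) \le t\}$, $B \subset \mathbb{R}$ Borel, $t \in \mathbb{R}$. "Depending measurably" means that the map $(\theta_1,\ldots,\theta_n) \mapsto \pi_{\theta_1,\ldots,\theta_n}$ from $\mathbb{R}^n$ (with Borel $\sigma$-algebra) to $\mathscr{P}(\mathbb{R})$ is measurable. For $\pi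 \in \mathscr{P}(\mathbb{R})$, $\pi^n$ is the product measure of $\pi$ with itself $n$ times on $\mathbb{R}^n$. A bounded signed measure is a finite (real-valued) countably additive set function on the Borel sets. *)

theory Defs
  imports "HOL-Probability.Probability"
begin

text \<open>The Euclidean space of dimension \<open>n\<close> is \<^typ>\<open>real ^ 'n\<close>, with \<open>n\<close> the
  cardinality of the (nonempty, finite) index type \<^typ>\<open>'n\<close>.\<close>

definition exchangeable :: "'a measure \<Rightarrow> ('a \<Rightarrow> real ^ 'n) \<Rightarrow> bool" where
  "exchangeable M X \<longleftrightarrow>
     (\<forall>\<sigma>. \<sigma> permutes (UNIV :: 'n set) \<longrightarrow>
       (\<forall>B \<in> sets borel.
          measure M {\<omega> \<in> space M. (\<chi> i. X \<omega> $ \<sigma> i) \<in> B} = measure M {\<omega> \<in> space M. X \<omega> \<in> B}))"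

definition measure_power :: "real measure \<Rightarrow> (real ^ 'n) measure" where
  "measure_power \<pi> = distr (Pi\<^sub>M (UNIV :: 'n set) (\<lambda>_. \<pi>)) borel (\<lambda>x. \<chi> i. x i)"

lemma measurable_vec_lambda_PiM:
  assumes "sets \<pi> = sets (borel :: real measure)"
  shows "(\<lambda>x. \<chi> i. x i) \<in> Pi\<^sub>M (UNIV :: 'n::finite set) (\<lambda>_. \<pi>) \<rightarrow>\<^sub>M borel"
proof (rule borel_measurable_euclidean_space[THEN iffD2], safe)
  fix b :: "real ^ 'n"
  assume "b \<in> Basis"
  then obtain j where b: "b = axis j 1" by (auto simp: Basis_vec_def)
  have "(\<lambda>x. x j) \<in> Pi\<^sub>M (UNIV :: 'n set) (\<lambda>_. \<pi>) \<rightarrow>\<^sub>M \<pi>" by simp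
  also have "?this \<longleftrightarrow> (\<lambda>x. x j) \<in> Pi\<^sub>M (UNIV :: 'n set) (\<lambda>_. \<pi>) \<rightarrow>\<^sub>M borel"
    using measurable_cong_sets[OF refl assms] by blast
  finally show "(\<lambda>x. (\<chi> i. x i) \<bullet> b) \<in> borel_measurable (Pi\<^sub>M (UNIV :: 'n set) (\<lambda>_. \<pi>))"
    by (simp add: b inner_axis)
qed

lemma measure_power_box:
  fixes B :: "'n::finite \<Rightarrow> real set"
  assumes \<pi>: "prob_space \<pi>" "sets \<pi> = sets borel" and B: "\<And>i. B i \<in> sets borel"
  shows "measure (measure_power \<pi>) {x. \<forall>i. x $ i \<in> B i} = (\<Prod>i\<in>UNIV. measure \<pi> (B i))"
proof -
  interpret finite_product_prob_space "\<lambda>_::'n. \<pi>" UNIV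
    using \<pi>(1) by (auto simp: finite_product_prob_space_def finite_product_sigma_finite_def
        product_prob_space_def product_prob_space_axioms_def finite_product_sigma_finite_axioms_def
        product_sigma_finite_def prob_space_imp_sigma_finite)
  have [measurable]: "{x :: real ^ 'n. \<forall>i. x $ i \<in> B i} \<in> sets borel"
    using B by measurable
  have "space \<pi> = UNIV" using sets_eq_imp_space_eq[OF \<pi>(2)] by simp
  then have "(\<lambda>x. \<chi> i. x i) -` {x. \<forall>i. x $ i \<in> B i} \<inter> space (Pi\<^sub>M (UNIV :: 'n set) (\<lambda>_. \<pi>)) =
      Pi\<^sub>E UNIV B"
    by (auto simp: space_PiM PiE_def Pi_def)
  then show ?thesis
    unfolding measure_power_def
    using measurable_vec_lambda_PiM[OF \<pi>(2), where 'n = 'n] B \<pi>(2)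
    by (simp add: measure_distr finite_measure_PiM_emb)
qed

text \<open>Since \<open>\<eta>\<close> is real-valued, countable additivity already makes it bounded. Only its
  values on \<^term>\<open>sets M\<close> matter.\<close>

definition bounded_signed_measure :: "'a measure \<Rightarrow> ('a set \<Rightarrow> real) \<Rightarrow> bool" where
  "bounded_signed_measure M \<eta> \<longleftrightarrow>
     \<eta> {} = 0 \<and>
     (\<forall>A :: nat \<Rightarrow> 'a set. range A \<subseteq> sets M \<longrightarrow> disjoint_family A \<longrightarrow>
        (\<lambda>i. \<eta> (A i)) sums \<eta> (\<Union>i. A i))"

text \<open>The two parts of the Jordan decomposition: \<open>\<eta>\<^sup>+(A)\<close> is the supremum of \<open>\<eta>(B)\<close> over the
  measurable \<open>B \<subseteq> A\<close>. The truncation of negative values by \<^const>\<open>ennreal\<close> is harmless, as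
  \<open>B = {}\<close> contributes \<open>0\<close>.\<close>

definition pos_variation :: "'a measure \<Rightarrow> ('a set \<Rightarrow> real) \<Rightarrow> 'a measure" where
  "pos_variation M \<eta> =
     measure_of (space M) (sets M) (\<lambda>A. SUP B \<in> {B \<in> sets M. B \<subseteq> A}. ennreal (\<eta> B))"

definition neg_variation :: "'a measure \<Rightarrow> ('a set \<Rightarrow> real) \<Rightarrow> 'a measure" where
  "neg_variation M \<eta> = pos_variation M (\<lambda>A. - \<eta> A)"

definition signed_integral :: "'a measure \<Rightarrow> ('a set \<Rightarrow> real) \<Rightarrow> ('a \<Rightarrow> real) \<Rightarrow> real" where
  "signed_integral M \<eta> f =
     integral\<^sup>L (pos_variation M \<eta>) f - integral\<^sup>L (neg_variation M \<eta>) f"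

text \<open>The set function used in \<^const>\<open>pos_variation\<close> is indeed a measure, so that
  \<^const>\<open>measure_of\<close> does not collapse it to the null measure.\<close>

lemma bounded_signed_measure_Un:
  assumes "bounded_signed_measure M \<eta>" "A \<in> sets M" "B \<in> sets M" "A \<inter> B = {}"
  shows "\<eta> (A \<union> B) = \<eta> A + \<eta> B"
proof -
  have r: "range (binaryset A B) \<subseteq> sets M"
    using assms by (simp add: range_binaryset_eq)
  have d: "disjoint_family (binaryset A B)"
    using assms(4) by (auto simp: disjoint_family_on_def binaryset_def)
  have 1: "(\<lambda>i. \<eta> (binaryset A B i)) sums \<eta> (\<Union>i. binaryset A B i)"
    using assms(1) r d unfolding bounded_signed_measure_def by blast
  have 2: "(\<lambda>i. \<eta> (binaryset A B i)) sums (\<eta> A + \<eta> B)"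
    using assms by (intro binaryset_sums) (auto simp: bounded_signed_measure_def)
  show ?thesis using sums_unique2[OF 1 2] by (simp add: UN_binaryset_eq)
qed

lemma sets_pos_variation [simp]: "sets (pos_variation M \<eta>) = sets M"
  by (simp add: pos_variation_def)

lemma space_pos_variation [simp]: "space (pos_variation M \<eta>) = space M"
  by (simp add: pos_variation_def)

lemma ennreal_sums_le:
  fixes f :: "nat \<Rightarrow> real"
  assumes "f sums s"
  shows "ennreal s \<le> (\<Sum>i. ennreal (f i))"
proof (rule LIMSEQ_le_const2)
  show "(\<lambda>n. ennreal (\<Sum>i<n. f i)) \<longlonglongrightarrow> ennreal s"
    using assms by (intro tendsto_ennrealI) (simp add: sums_def)
  have "ennreal (\<Sum>i<n. f i) \<le> (\<Sum>i. ennreal (f i))" for n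
  proof -
    have "ennreal (\<Sum>i<n. f i) \<le> ennreal (\<Sum>i<n. max 0 (f i))"
      by (intro ennreal_leI sum_mono) auto
    also have "\<dots> = (\<Sum>i<n. ennreal (max 0 (f i)))" by (rule sum_ennreal[symmetric]) simp
    also have "\<dots> = (\<Sum>i<n. ennreal (f i))" by (intro sum.cong) (auto simp: max_def ennreal_neg)
    also have "\<dots> \<le> (\<Sum>i. ennreal (f i))" by (intro sum_le_suminf) auto
    finally show ?thesis .
  qed
  then show "\<exists>N. \<forall>n\<ge>N. ennreal (\<Sum>i<n. f i) \<le> (\<Sum>i. ennreal (f i))" by blast
qed

lemma emeasure_pos_variation:
  assumes \<eta>: "bounded_signed_measure M \<eta>" and A: "A \<in> sets M"
  shows "emeasure (pos_variation M \<eta>) A = (SUP B \<in> {B \<in> sets M. B \<subseteq> A}. ennreal (\<eta> B))"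
proof -
  define \<mu> where "\<mu> A = (SUP B \<in> {B \<in> sets M. B \<subseteq> A}. ennreal (\<eta> B))" for A
  have \<eta>0: "\<eta> {} = 0" using \<eta> by (simp add: bounded_signed_measure_def)
  have up: "ennreal (\<eta> B) \<le> \<mu> A" if "B \<in> sets M" "B \<subseteq> A" for A B
    unfolding \<mu>_def using that by (intro SUP_upper) auto
  have \<mu>0: "\<mu> {} = 0"
  proof -
    have "{B \<in> sets M. B \<subseteq> {}} = {{}}" by auto
    then show ?thesis by (simp add: \<mu>_def \<eta>0)
  qed
  have super: "\<mu> A + \<mu> A' \<le> \<mu> (A \<union> A')" if "A \<inter> A' = {}" for A A'
  proof -
    have 1: "ennreal (\<eta> B) + ennreal (\<eta> B') \<le> \<mu> (A \<union> A')"
      if B: "B \<in> sets M" "B \<subseteq> A" "B' \<in> sets M" "B' \<subseteq> A'" for B B'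
    proof (cases "0 \<le> \<eta> B \<and> 0 \<le> \<eta> B'")
      case True
      then have "ennreal (\<eta> B) + ennreal (\<eta> B') = ennreal (\<eta> (B \<union> B'))"
        using B \<open>A \<inter> A' = {}\<close> by (subst bounded_signed_measure_Un[OF \<eta>]) auto
      also have "\<dots> \<le> \<mu> (A \<union> A')" using B by (intro up) auto
      finally show ?thesis .
    next
      case False
      have "ennreal (\<eta> B) \<le> \<mu> (A \<union> A')" "ennreal (\<eta> B') \<le> \<mu> (A \<union> A')"
        using B by (auto intro!: up)
      with False show ?thesis by (auto simp: not_le ennreal_neg)
    qed
    have ne: "{B \<in> sets M. B \<subseteq> C} \<noteq> {}" for C by auto
    have "ennreal (\<eta> B) + \<mu> A' \<le> \<mu> (A \<union> A')" if "B \<in> sets M" "B \<subseteq> A" for B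
      unfolding \<mu>_def[of A'] ennreal_SUP_add_right[OF ne]
      by (rule SUP_least) (use 1 that in auto)
    then show ?thesis
      unfolding \<mu>_def[of A] ennreal_SUP_add_left[OF ne, symmetric]
      by (intro SUP_least) auto
  qed
  have mono: "\<mu> A \<le> \<mu> A'" if "A \<subseteq> A'" for A A'
    unfolding \<mu>_def using that by (intro SUP_subset_mono) auto
  have "countably_additive (sets M) \<mu>"
  proof (rule countably_additiveI)
    fix F :: "nat \<Rightarrow> 'a set"
    assume F: "range F \<subseteq> sets M" "disjoint_family F" "\<Union>(range F) \<in> sets M"
    show "(\<Sum>i. \<mu> (F i)) = \<mu> (\<Union>(range F))"
    proof (rule antisym)
      have "(\<Sum>i<n. \<mu> (F i)) \<le> \<mu> (\<Union>i<n. F i)" for n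
      proof (induction n)
        case 0
        then show ?case by (simp add: \<mu>0)
      next
        case (Suc n)
        have "(\<Union>i<n. F i) \<inter> F n = {}"
          using F(2) by (auto simp: disjoint_family_on_def) (metis IntI empty_iff nat_neq_iff)
        then have "\<mu> (\<Union>i<n. F i) + \<mu> (F n) \<le> \<mu> (\<Union>i<Suc n. F i)"
          using super[of "\<Union>i<n. F i" "F n"] by (simp add: lessThan_Suc Un_commute)
        moreover have "(\<Sum>i<Suc n. \<mu> (F i)) \<le> \<mu> (\<Union>i<n. F i) + \<mu> (F n)"
          using add_right_mono[OF Suc] by simp
        ultimately show ?case by (rule order_trans[rotated])
      qed
      then have "(\<Sum>i<n. \<mu> (F i)) \<le> \<mu> (\<Union>(range F))" for n
        by (rule order_trans) (auto intro!: mono)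
      then show "(\<Sum>i. \<mu> (F i)) \<le> \<mu> (\<Union>(range F))"
        by (intro suminf_le_const) auto
    next
      have "ennreal (\<eta> B) \<le> (\<Sum>i. \<mu> (F i))" if B: "B \<in> sets M" "B \<subseteq> \<Union>(range F)" for B
      proof -
        have "range (\<lambda>i. B \<inter> F i) \<subseteq> sets M" using B F(1) by auto
        moreover have "disjoint_family (\<lambda>i. B \<inter> F i)"
          using F(2) by (rule disjoint_family_subset) auto
        ultimately have "(\<lambda>i. \<eta> (B \<inter> F i)) sums \<eta> (\<Union>i. B \<inter> F i)"
          using \<eta> unfolding bounded_signed_measure_def by blast
        moreover have "(\<Union>i. B \<inter> F i) = B" using B by auto
        ultimately have "ennreal (\<eta> B) \<le> (\<Sum>i. ennreal (\<eta> (B \<inter> F i)))"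
          by (intro ennreal_sums_le) simp
        also have "\<dots> \<le> (\<Sum>i. \<mu> (F i))"
          using B F by (intro suminf_le up) auto
        finally show ?thesis .
      qed
      then show "\<mu> (\<Union>(range F)) \<le> (\<Sum>i. \<mu> (F i))"
        unfolding \<mu>_def[of "\<Union>(range F)"] by (intro SUP_least) auto
    qed
  qed
  moreover have "positive (sets M) \<mu>" by (simp add: positive_def \<mu>0)
  ultimately show ?thesis
    using A emeasure_measure_of_sigma[of "space M" "sets M" \<mu> A]
    by (simp add: pos_variation_def \<mu>_def[abs_def] sets.sigma_algebra_axioms)
qed

text \<open>The \<open>\<sigma>\<close>-algebra of \<^term>\<open>prob_algebra borel\<close> is generated by the sets of all \<open>\<pi>\<close> with
  \<open>\<pi>(B) \<le> t\<close>.\<close>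

lemma sets_prob_algebra_borel:
  defines "P \<equiv> space (prob_algebra (borel :: real measure))"
  shows "sets (prob_algebra (borel :: real measure)) =
    sigma_sets P {{\<pi> \<in> P. measure \<pi> B \<le> t} | B t. B \<in> sets borel}"
    (is "_ = sigma_sets P ?G")
proof -
  have P: "prob_space \<pi> \<and> sets \<pi> = sets borel" if "\<pi> \<in> P" for \<pi>
    using that by (auto simp: P_def space_prob_algebra)
  have G: "?G \<subseteq> Pow P" by auto
  define S where "S = sigma P ?G"
  have S: "space S = P" "sets S = sigma_sets P ?G"
    using G by (simp_all add: S_def)
  have "(\<lambda>\<pi>. measure \<pi> B) \<in> borel_measurable S" if "B \<in> sets borel" for B
    unfolding borel_measurable_iff_le S using that by (auto intro!: sigma_sets.Basic)
  then have "(\<lambda>\<pi>. \<pi>) \<in> S \<rightarrow>\<^sub>M prob_algebra borel"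
  proof (intro measurable_prob_algebraI measurable_subprob_algebra)
    fix B :: "real set"
    assume *: "\<And>B. B \<in> sets borel \<Longrightarrow> (\<lambda>\<pi>. measure \<pi> B) \<in> borel_measurable S"
      and B: "B \<in> sets borel"
    have "(\<lambda>\<pi>. ennreal (measure \<pi> B)) \<in> borel_measurable S" using *[OF B] by simp
    then show "(\<lambda>\<pi>. emeasure \<pi> B) \<in> borel_measurable S"
      by (rule measurable_cong[THEN iffD1, rotated])
        (use P S in \<open>auto simp: prob_space_def finite_measure.emeasure_eq_measure\<close>)
  qed (use P S in \<open>auto intro: prob_space_imp_subprob_space\<close>)
  then have "sets (prob_algebra borel) \<subseteq> sets S"
  proof (intro subsetI)
    fix A :: "real measure set"
    assume m: "(\<lambda>\<pi>. \<pi>) \<in> S \<rightarrow>\<^sub>M prob_algebra borel" and A: "A \<in> sets (prob_algebra borel)"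
    have "A \<subseteq> P" using sets.sets_into_space[OF A] by (simp add: P_def)
    then have "(\<lambda>\<pi>. \<pi>) -` A \<inter> space S = A" using S by auto
    with measurable_sets[OF m A] show "A \<in> sets S" by simp
  qed
  moreover have "sigma_sets P ?G \<subseteq> sets (prob_algebra borel)"
  proof (unfold P_def, rule sets.sigma_sets_subset, safe)
    fix B :: "real set" and t :: real
    assume B [measurable]: "B \<in> sets borel"
    have "(\<lambda>\<pi>. measure \<pi> B) \<in> borel_measurable (prob_algebra borel)"
      using B by (intro measurable_compose[OF _ measurable_measure_subprob_algebra]
          measurable_prob_algebraD measurable_ident_sets) auto
    then show "{\<pi> \<in> space (prob_algebra borel). measure \<pi> B \<le> t} \<in> sets (prob_algebra borel)"
      by simp
  qed
  ultimately show ?thesis using S by auto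
qed

end

(* Polarization writes the symmetrized point mass at x as a signed combination of product powers:
   the sum over all permutations \<sigma> of the Dirac masses at x o \<sigma> equals the sum over S \<subseteq> {1..n} of
   (-1)^(n - |S|) |S|^n times the n-th power of the uniform distribution on (x_i, i \<in> S).
   By exchangeability, averaging over x = X and dividing by n! gives the law of X. The pairs (S, x)
   are encoded as single points \<theta> of R^n, and \<eta> combines the laws of the encodings of (S, X). *)

theory Submission
  imports Defs
begin

subsection \<open>Integration against linear combinations of finite measures\<close>

lemma bounded_signed_measure_uminus:
  "bounded_signed_measure M \<eta> \<Longrightarrow> bounded_signed_measure M (\<lambda>A. - \<eta> A)"
  by (auto simp: bounded_signed_measure_def intro!: sums_minus)

lemma bounded_signed_measure_sum:
  fixes N :: "'i \<Rightarrow> 'a measure"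
  assumes "\<And>i. i \<in> I \<Longrightarrow> finite_measure (N i)" "\<And>i. i \<in> I \<Longrightarrow> sets (N i) = sets M"
  shows "bounded_signed_measure M (\<lambda>A. \<Sum>i\<in>I. c i * measure (N i) A)"
  unfolding bounded_signed_measure_def
  using assms
  by (auto intro!: sums_sum sums_mult finite_measure.finite_measure_UNION)

lemma finite_measure_pos_variation:
  assumes \<eta>: "bounded_signed_measure M \<eta>"
    and K: "\<And>A. A \<in> sets M \<Longrightarrow> \<eta> A \<le> K"
  shows "finite_measure (pos_variation M \<eta>)"
proof
  have "emeasure (pos_variation M \<eta>) (space M) \<le> ennreal K"
    unfolding emeasure_pos_variation[OF \<eta> sets.top]
    by (intro SUP_least ennreal_leI K) auto
  also have "\<dots> < \<infinity>" by simp
  finally show "emeasure (pos_variation M \<eta>) (space (pos_variation M \<eta>)) \<noteq> \<infinity>"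
    by simp
qed

text \<open>For measurable \<open>B\<close> inside \<open>A\<close>,
  \<open>\<eta> B = \<eta> A - \<eta> (A - B)\<close>, and \<open>- \<eta> (A - B)\<close> is at
  most the negative variation of \<open>A\<close>. Taking the supremum over \<open>B\<close> gives
  half of the Jordan identity.\<close>

lemma measure_pos_variation_le:
  assumes \<eta>: "bounded_signed_measure M \<eta>"
    and fin: "finite_measure (neg_variation M \<eta>)"
    and A: "A \<in> sets M"
  shows "measure (pos_variation M \<eta>) A \<le> \<eta> A + measure (neg_variation M \<eta>) A"
proof -
  let ?q = "measure (neg_variation M \<eta>) A"
  have q: "- \<eta> C \<le> ?q" if "C \<in> sets M" "C \<subseteq> A" for C
  proof -
    have "ennreal (- \<eta> C) \<le> emeasure (neg_variation M \<eta>) A"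
      unfolding neg_variation_def
        emeasure_pos_variation[OF bounded_signed_measure_uminus[OF \<eta>] A]
      using that by (intro SUP_upper) auto
    then show ?thesis
      by (simp add: finite_measure.emeasure_eq_measure[OF fin] ennreal_le_iff)
  qed
  have B: "\<eta> B \<le> \<eta> A + ?q" if "B \<in> sets M" "B \<subseteq> A" for B
  proof -
    have "\<eta> (B \<union> (A - B)) = \<eta> B + \<eta> (A - B)"
      using that A by (intro bounded_signed_measure_Un[OF \<eta>]) auto
    moreover have "B \<union> (A - B) = A" using that by auto
    ultimately show ?thesis using q[of "A - B"] that A by auto
  qed
  have "emeasure (pos_variation M \<eta>) A \<le> ennreal (\<eta> A + ?q)"
    unfolding emeasure_pos_variation[OF \<eta> A]
    by (intro SUP_least ennreal_leI B) auto
  \<comment> \<open>The case \<open>B = {}\<close>. It rules out truncation by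
    \<open>ennreal\<close> in the bound just obtained.\<close>
  moreover have "0 \<le> \<eta> A + ?q"
    using B[of "{}"] \<eta> by (simp add: bounded_signed_measure_def)
  ultimately show ?thesis by (simp add: measure_def enn2real_leI)
qed

text \<open>Negating \<open>\<eta>\<close> swaps the two variations, so the preceding inequality for
  \<open>\<eta>\<close> and for its negative gives both directions. The bound \<open>K\<close> makes
  the variations finite.\<close>

lemma jordan_decomposition:
  assumes \<eta>: "bounded_signed_measure M \<eta>"
    and K: "\<And>A. A \<in> sets M \<Longrightarrow> \<bar>\<eta> A\<bar> \<le> K"
  shows "finite_measure (pos_variation M \<eta>)" "finite_measure (neg_variation M \<eta>)"
    and "A \<in> sets M \<Longrightarrow>
      measure (pos_variation M \<eta>) A - measure (neg_variation M \<eta>) A = \<eta> A"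
proof -
  note \<eta>' = bounded_signed_measure_uminus[OF \<eta>]
  have n: "neg_variation M (\<lambda>A. - \<eta> A) = pos_variation M \<eta>"
    by (simp add: neg_variation_def)
  show p: "finite_measure (pos_variation M \<eta>)"
    using K by (intro finite_measure_pos_variation[OF \<eta>, of K]) (auto simp: abs_le_iff)
  show q: "finite_measure (neg_variation M \<eta>)"
    unfolding neg_variation_def
    using K by (intro finite_measure_pos_variation[OF \<eta>', of K]) (auto simp: abs_le_iff)
  show "measure (pos_variation M \<eta>) A - measure (neg_variation M \<eta>) A = \<eta> A"
    if A: "A \<in> sets M"
    using measure_pos_variation_le[OF \<eta> q A] measure_pos_variation_le[OF \<eta>' _ A] p
    unfolding n by (simp add: neg_variation_def)
qed

text \<open>Standard induction from indicators to nonnegative measurable functions. The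
  integrability assumptions enter the induction because differences and signed sums of integrals
  must stay finite at each stage.\<close>

lemma integral_diff_eq_sum_integral:
  fixes N :: "'i \<Rightarrow> 'a measure"
  assumes fin: "finite_measure P" "finite_measure Q" "\<And>i. i \<in> I \<Longrightarrow> finite_measure (N i)"
    and sets: "sets P = sets M" "sets Q = sets M" "\<And>i. i \<in> I \<Longrightarrow> sets (N i) = sets M"
    and eq: "\<And>A. A \<in> sets M \<Longrightarrow>
      measure P A - measure Q A = (\<Sum>i\<in>I. c i * measure (N i) A)"
    and f: "f \<in> borel_measurable M" "\<And>x. 0 \<le> f x"
    and int: "integrable P f" "integrable Q f" "\<And>i. i \<in> I \<Longrightarrow> integrable (N i) f"
  shows "integral\<^sup>L P f - integral\<^sup>L Q f = (\<Sum>i\<in>I. c i * integral\<^sup>L (N i) f)"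
  using f int
proof (induction rule: borel_measurable_induct_real)
  case (set A)
  have "A \<subseteq> space M" using set(1) by (rule sets.sets_into_space)
  then have "A \<inter> space P = A" "A \<inter> space Q = A" "\<And>i. i \<in> I \<Longrightarrow> A \<inter> space (N i) = A"
    using sets[THEN sets_eq_imp_space_eq] by auto
  then show ?case using eq[OF set(1)] by simp
next
  case (mult u k)
  \<comment> \<open>Integrability of \<open>k * u\<close> says nothing about \<open>u\<close> when
    \<open>k = 0\<close>, but then both sides vanish.\<close>
  show ?case
  proof (cases "k = 0")
    case False
    with mult have "integral\<^sup>L P u - integral\<^sup>L Q u = (\<Sum>i\<in>I. c i * integral\<^sup>L (N i) u)"
      by auto
    then have "k * (integral\<^sup>L P u - integral\<^sup>L Q u) = k * (\<Sum>i\<in>I. c i * integral\<^sup>L (N i) u)"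
      by simp
    then show ?thesis by (simp add: right_diff_distrib sum_distrib_left mult.left_commute)
  qed simp
next
  case (add u v)
  have m: "u \<in> borel_measurable L" "v \<in> borel_measurable L" if "sets L = sets M" for L
    using add.hyps by (simp_all add: measurable_cong_sets[OF that refl])
  \<comment> \<open>Both summands are nonnegative, hence dominated by their sum.\<close>
  have i: "integrable L u" "integrable L v"
    if "integrable L (\<lambda>x. v x + u x)" "sets L = sets M" for L
    using add.hyps m[OF that(2)] by (auto intro!: Bochner_Integration.integrable_bound[OF that(1)])
  note ints = i[OF add.prems(1) sets(1)] i[OF add.prems(2) sets(2)] i[OF add.prems(3) sets(3)]
  have "integral\<^sup>L P u - integral\<^sup>L Q u = (\<Sum>i\<in>I. c i * integral\<^sup>L (N i) u)"
    "integral\<^sup>L P v - integral\<^sup>L Q v = (\<Sum>i\<in>I. c i * integral\<^sup>L (N i) v)"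
    using add.IH ints by auto
  with ints show ?case by (simp add: distrib_left sum.distrib)
next
  case (seq U)
  \<comment> \<open>The limit \<open>f\<close> dominates its increasing approximations, so dominated
    convergence applies to every measure involved.\<close>
  have le: "U k x \<le> f x" if "x \<in> space M" for k x
    using seq that by (intro incseq_le) (auto simp: incseq_def le_fun_def)
  have m: "f \<in> borel_measurable L" "U k \<in> borel_measurable L" if "sets L = sets M" for L k
    using seq.hyps f(1) by (simp_all add: measurable_cong_sets[OF that refl])
  have i: "integrable L (U k)" "(\<lambda>k. integral\<^sup>L L (U k)) \<longlonglongrightarrow> integral\<^sup>L L f"
    if L: "integrable L f" "sets L = sets M" for L k
  proof -
    have "space L = space M" using L(2) by (rule sets_eq_imp_space_eq)
    with le f(2) seq.hyps have *: "AE x in L. norm (U k x) \<le> f x" "AE x in L. norm (U k x) \<le> norm (f x)"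
      "AE x in L. (\<lambda>k. U k x) \<longlonglongrightarrow> f x" for k
      by (auto intro!: AE_I2)
    show "integrable L (U k)"
      using L m[OF L(2)] * by (intro Bochner_Integration.integrable_bound[OF L(1)]) auto
    show "(\<lambda>k. integral\<^sup>L L (U k)) \<longlonglongrightarrow> integral\<^sup>L L f"
      using L m[OF L(2)] * by (intro integral_dominated_convergence[where w = f])
  qed
  have "(\<lambda>k. integral\<^sup>L P (U k) - integral\<^sup>L Q (U k)) \<longlonglongrightarrow> integral\<^sup>L P f - integral\<^sup>L Q f"
    using seq.prems sets by (intro tendsto_diff i)
  moreover have "(\<lambda>k. \<Sum>j\<in>I. c j * integral\<^sup>L (N j) (U k)) \<longlonglongrightarrow> (\<Sum>j\<in>I. c j * integral\<^sup>L (N j) f)"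
    using seq.prems sets by (intro tendsto_sum tendsto_mult_left i)
  moreover have "integral\<^sup>L P (U k) - integral\<^sup>L Q (U k) = (\<Sum>j\<in>I. c j * integral\<^sup>L (N j) (U k))" for k
    using seq.prems sets by (intro seq.IH i)
  ultimately show ?case by (simp add: LIMSEQ_unique)
qed

text \<open>The \<open>N i\<close> may overlap and cancel, so the variations of the combination need
  not be its parts with positive and negative coefficients. The difference of the variations is
  nevertheless the combination itself, which determines the integral.\<close>

lemma signed_integral_sum:
  fixes N :: "'i \<Rightarrow> 'a measure"
  assumes fin: "\<And>i. i \<in> I \<Longrightarrow> finite_measure (N i)"
    and sets: "\<And>i. i \<in> I \<Longrightarrow> sets (N i) = sets M"
    and f: "f \<in> borel_measurable M" "\<And>x. 0 \<le> f x" "\<And>x. f x \<le> K"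
  shows "signed_integral M (\<lambda>A. \<Sum>i\<in>I. c i * measure (N i) A) f = (\<Sum>i\<in>I. c i * integral\<^sup>L (N i) f)"
proof -
  define \<eta> where "\<eta> A = (\<Sum>i\<in>I. c i * measure (N i) A)" for A
  have \<eta>: "bounded_signed_measure M \<eta>"
    unfolding \<eta>_def[abs_def] using fin sets by (rule bounded_signed_measure_sum)
  have "\<bar>\<eta> A\<bar> \<le> (\<Sum>i\<in>I. \<bar>c i\<bar> * measure (N i) (space (N i)))" for A
    unfolding \<eta>_def
    by (rule order_trans[OF sum_abs])
      (auto simp: abs_mult intro!: sum_mono mult_left_mono finite_measure.bounded_measure fin)
  note J = jordan_decomposition[OF \<eta> this]
  have int: "integrable P f" if "finite_measure P" "sets P = sets M" for P
    using f by (intro finite_measure.integrable_const_bound[OF that(1), of _ K])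
      (auto simp: measurable_cong_sets[OF that(2) refl])
  have eq: "measure (pos_variation M \<eta>) A - measure (neg_variation M \<eta>) A =
      (\<Sum>i\<in>I. c i * measure (N i) A)" if "A \<in> sets M" for A
    using J(3)[OF that] by (simp add: \<eta>_def[abs_def])
  have "sets (pos_variation M \<eta>) = sets M" "sets (neg_variation M \<eta>) = sets M"
    by (simp_all add: neg_variation_def)
  then have "signed_integral M \<eta> f = (\<Sum>i\<in>I. c i * integral\<^sup>L (N i) f)"
    unfolding signed_integral_def
    by (intro integral_diff_eq_sum_integral[where M = M] int J(1,2) fin sets eq f)
  then show ?thesis by (simp add: \<eta>_def[abs_def])
qed

subsection \<open>Powers of discrete measures\<close>

text \<open>The power is the law of \<open>x\<close> along a random index map \<open>g\<close> whose
  coordinates are independent with law \<open>q\<close>. Summing over index maps rather than points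
  allows coinciding values of \<open>x\<close>.\<close>

lemma measure_power_distr_pmf:
  fixes q :: "'n::finite pmf" and x :: "'n \<Rightarrow> real"
  assumes A: "A \<in> sets borel"
  shows "measure (measure_power (distr (measure_pmf q) borel (\<lambda>i. x i)) :: (real ^ 'n) measure) A =
    (\<Sum>g\<in>UNIV. (\<Prod>i\<in>UNIV. pmf q (g i)) * indicator A (\<chi> i. x (g i)))"
proof -
  let ?D = "distr (measure_pmf q) borel (\<lambda>i. x i)"
  let ?Q = "Pi_pmf (UNIV :: 'n set) undefined (\<lambda>_. q)"
  let ?\<Pi> = "Pi\<^sub>M (UNIV :: 'n set) (\<lambda>_. ?D)"
  let ?h = "\<lambda>g i. x (g i)"
  have D: "prob_space ?D" by (intro measure_pmf.prob_space_distr) simp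
  then interpret product_sigma_finite "\<lambda>_ :: 'n. ?D"
    by (simp add: product_sigma_finite_def prob_space_imp_sigma_finite)
  have h: "?h \<in> measure_pmf ?Q \<rightarrow>\<^sub>M ?\<Pi>" by (auto simp: space_PiM PiE_def)
  \<comment> \<open>A product measure is determined by boxes, and on boxes independence of the
    indices gives the product.\<close>
  have "distr (measure_pmf ?Q) ?\<Pi> ?h = ?\<Pi>"
  proof (rule PiM_eqI)
    fix B :: "'n \<Rightarrow> real set"
    assume B: "\<And>i. i \<in> UNIV \<Longrightarrow> B i \<in> sets ?D"
    have "?h -` Pi\<^sub>E UNIV B = Pi UNIV (\<lambda>i. (\<lambda>j. x j) -` B i)"
      by (auto simp: PiE_def)
    moreover have "Pi\<^sub>E UNIV B \<in> sets ?\<Pi>" using B by (intro sets_PiM_I_finite) auto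
    ultimately show "emeasure (distr (measure_pmf ?Q) ?\<Pi> ?h) (Pi\<^sub>E UNIV B) =
        (\<Prod>i\<in>UNIV. emeasure ?D (B i))"
      using B h
      by (simp add: emeasure_distr measure_pmf.emeasure_eq_measure measure_Pi_pmf_Pi prod_ennreal)
  qed auto
  then have "measure_power ?D = distr (distr (measure_pmf ?Q) ?\<Pi> ?h) borel (\<lambda>y. \<chi> i. y i)"
    by (simp add: measure_power_def)
  also have "\<dots> = distr (measure_pmf ?Q) borel (\<lambda>g. \<chi> i. x (g i))"
    using h by (subst distr_distr) (auto simp: o_def intro!: measurable_vec_lambda_PiM)
  finally have "measure (measure_power ?D :: (real ^ 'n) measure) A =
      measure_pmf.prob ?Q ((\<lambda>g. \<chi> i. x (g i)) -` A)"
    using A by (simp add: measure_distr)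
  also have "\<dots> = (\<Sum>g\<in>(\<lambda>g. \<chi> i. x (g i)) -` A. pmf ?Q g)"
    by (intro measure_measure_pmf_finite) simp
  also have "\<dots> = (\<Sum>g\<in>UNIV. (\<Prod>i\<in>UNIV. pmf q (g i)) * indicator A (\<chi> i. x (g i)))"
    by (rule sum.mono_neutral_cong_left) (auto simp: pmf_Pi)
  finally show ?thesis .
qed

text \<open>If \<open>A\<close> misses some index, its supersets of even and of odd size are equally
  many, so the signs cancel. The exponent has the parity of
  \<open>CARD('n) - card S\<close>.\<close>

lemma sum_supersets_alternating:
  fixes A :: "'n::finite set"
  shows "(\<Sum>S | A \<subseteq> S. (-1) ^ (CARD('n) + card S)) = (if A = UNIV then 1 else 0 :: real)"
proof (cases "A = UNIV")
  case True
  then have "{S. A \<subseteq> S} = {UNIV}" by auto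
  then show ?thesis using True by simp
next
  case False
  then have "card {S. S \<subseteq> UNIV \<and> A \<subseteq> S \<and> even (card S)} = card {S. S \<subseteq> UNIV \<and> A \<subseteq> S \<and> odd (card S)}"
    by (intro card_subsupersets_even_odd) auto
  then have "(\<Sum>S | A \<subseteq> S. (-1) ^ card S) = (0 :: real)"
    by (intro sum_alternating_cancels) auto
  then show ?thesis using False by (simp add: power_add flip: sum_distrib_left)
qed

text \<open>For \<open>S = {}\<close> the value of \<^const>\<open>pmf_of_set\<close> is unspecified, but the coefficient
  vanishes because the index type is nonempty.\<close>

lemma polarization_measure_power:
  fixes x :: "real ^ 'n"
  assumes A: "A \<in> sets borel"
  shows "(\<Sum>S\<in>UNIV. (-1) ^ (CARD('n) + card S) * real (card S) ^ CARD('n) *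
        measure (measure_power (distr (measure_pmf (pmf_of_set S)) borel (\<lambda>i. x $ i))
          :: (real ^ 'n) measure) A) =
     (\<Sum>\<sigma> | \<sigma> permutes UNIV. indicator A (\<chi> i. x $ \<sigma> i))"
proof -
  let ?I = "\<lambda>g :: 'n \<Rightarrow> 'n. indicator A (\<chi> i. x $ g i) :: real"
  \<comment> \<open>The factor clears the uniform weights \<open>1 / card S\<close>, one per
    coordinate, so each map \<open>g\<close> into \<open>S\<close> counts exactly once.\<close>
  have 1: "real (card S) ^ CARD('n) * (\<Prod>i\<in>UNIV. pmf (pmf_of_set S) (g i)) = of_bool (range g \<subseteq> S)"
    for S :: "'n set" and g :: "'n \<Rightarrow> 'n"
  proof (cases "S = {}")
    case False
    then have "real (card S) ^ CARD('n) * (\<Prod>i\<in>UNIV. pmf (pmf_of_set S) (g i)) =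
        (\<Prod>i\<in>UNIV. indicator S (g i))"
      by (simp add: power_divide flip: prod.distrib prod_constant)
    also have "\<dots> = of_bool (range g \<subseteq> S)"
      by (auto simp: prod_zero_iff indicator_def intro!: prod.neutral)
    finally show ?thesis .
  qed simp
  have "(\<Sum>S\<in>UNIV. (-1) ^ (CARD('n) + card S) * real (card S) ^ CARD('n) *
        measure (measure_power (distr (measure_pmf (pmf_of_set S)) borel (\<lambda>i. x $ i))
          :: (real ^ 'n) measure) A) =
      (\<Sum>S\<in>UNIV. \<Sum>g\<in>UNIV. (-1) ^ (CARD('n) + card S) *
         (real (card S) ^ CARD('n) * (\<Prod>i\<in>UNIV. pmf (pmf_of_set S) (g i))) * ?I g)"
    by (simp only: measure_power_distr_pmf[OF A] sum_distrib_left mult.assoc)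
  also have "\<dots> = (\<Sum>g\<in>UNIV. \<Sum>S\<in>UNIV. (-1) ^ (CARD('n) + card S) * of_bool (range g \<subseteq> S) * ?I g)"
    unfolding 1 by (rule sum.swap)
  \<comment> \<open>For fixed \<open>g\<close> the coefficient is an alternating sum over the
    supersets of its range. Only surjections survive, and on a finite type these are the
    permutations.\<close>
  also have "\<dots> = (\<Sum>g\<in>UNIV. (\<Sum>S | range g \<subseteq> S. (-1) ^ (CARD('n) + card S)) * ?I g)"
    by (intro sum.cong refl, unfold sum_distrib_right, intro sum.mono_neutral_cong_right) auto
  also have "\<dots> = (\<Sum>g\<in>UNIV. if surj g then ?I g else 0)"
    unfolding sum_supersets_alternating by (intro sum.cong) auto
  also have "\<dots> = (\<Sum>g | surj g. ?I g)"
    by (intro sum.mono_neutral_cong_right) auto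
  also have "{g :: 'n \<Rightarrow> 'n. surj g} = {g. g permutes UNIV}"
  proof (intro Collect_cong iffI)
    fix g :: "'n \<Rightarrow> 'n" assume "surj g"
    then have "bij g" by (intro bijI finite_UNIV_surj_inj) auto
    then show "g permutes UNIV" by (rule bij_imp_permutes) simp
  qed (rule permutes_surj)
  finally show ?thesis .
qed

subsection \<open>The representation\<close>

text \<open>The parameter \<open>\<theta>\<close> encodes a set \<open>S\<close> of indices in the signs of its coordinates and a
  vector \<open>x\<close> in their absolute values.\<close>

definition sign_encode :: "'n set \<Rightarrow> real ^ 'n \<Rightarrow> real ^ 'n" where
  "sign_encode S x = (\<chi> i. (if i \<in> S then 1 else - 1) * exp (x $ i))"

text \<open>If no coordinate is positive, \<open>pmf_of_set {}\<close> is still some pmf, so every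
  \<theta> yields a probability measure.\<close>

definition decoded_measure :: "real ^ 'n \<Rightarrow> real measure" where
  "decoded_measure \<theta> = distr (measure_pmf (pmf_of_set {i. \<theta> $ i > 0})) borel (\<lambda>i. ln \<bar>\<theta> $ i\<bar>)"

section \<open>Measurability of encoding and decoding\<close>

lemma measurable_positive_coordinates:
  "(\<lambda>\<theta> :: real ^ 'n. {i. \<theta> $ i > 0}) \<in> borel \<rightarrow>\<^sub>M count_space UNIV"
proof -
  have "{\<theta> :: real ^ 'n. {i. \<theta> $ i > 0} = S} \<in> sets borel" for S
  proof -
    have "{\<theta> :: real ^ 'n. \<forall>i. (\<theta> $ i > 0) = (i \<in> S)} \<in> sets borel" by measurable
    also have "{\<theta> :: real ^ 'n. \<forall>i. (\<theta> $ i > 0) = (i \<in> S)} = {\<theta>. {i. \<theta> $ i > 0} = S}" by auto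
    finally show ?thesis .
  qed
  then show ?thesis
    by (auto simp: measurable_count_space_eq2 vimage_def)
qed

lemma decoded_measure_sign_encode:
  "decoded_measure (sign_encode S x) = distr (measure_pmf (pmf_of_set S)) borel (\<lambda>i. x $ i)"
proof -
  \<comment> \<open>Since \<open>exp\<close> is positive, the signs recover \<open>S\<close>
    exactly, and \<open>ln\<close> of the absolute values recovers \<open>x\<close>.\<close>
  have "{i. sign_encode S x $ i > 0} = S" "(\<lambda>i. ln \<bar>sign_encode S x $ i\<bar>) = (\<lambda>i. x $ i)"
    by (auto simp: sign_encode_def abs_mult)
  then show ?thesis by (simp add: decoded_measure_def)
qed

lemma borel_measurable_vec_lambda:
  fixes f :: "'a \<Rightarrow> 'n::finite \<Rightarrow> real"
  assumes "\<And>i. (\<lambda>x. f x i) \<in> borel_measurable M"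
  shows "(\<lambda>x. \<chi> i. f x i) \<in> borel_measurable M"
  unfolding borel_measurable_euclidean_space[where 'c = "real ^ 'n"]
  using assms by (auto simp: Basis_vec_def inner_axis)

lemma measurable_sign_encode [measurable]:
  fixes S :: "'n::finite set"
  shows "sign_encode S \<in> borel \<rightarrow>\<^sub>M borel"
  unfolding sign_encode_def[abs_def] by (intro borel_measurable_vec_lambda) measurable

text \<open>For a fixed pmf on indices, the pushforward depends measurably on \<theta>. The actual
  pmf depends on \<theta> only through the set of positive coordinates, which has finitely many
  values on measurable pieces.\<close>

lemma measurable_decoded_measure:
  "decoded_measure \<in> (borel :: (real ^ 'n) measure) \<rightarrow>\<^sub>M prob_algebra borel"
proof -
  have "(\<lambda>\<theta> :: real ^ 'n. distr (measure_pmf q) borel (\<lambda>i. ln \<bar>\<theta> $ i\<bar>)) \<in> borel \<rightarrow>\<^sub>M prob_algebra borel"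
    for q :: "'n pmf"
  proof (intro measurable_distr_prob_space2[where M = "measure_pmf q"])
    show "(\<lambda>\<theta>. measure_pmf q) \<in> borel \<rightarrow>\<^sub>M prob_algebra (measure_pmf q)"
      by (intro measurable_const) (simp add: space_prob_algebra measure_pmf.prob_space_axioms)
    show "(\<lambda>(\<theta> :: real ^ 'n, i). ln \<bar>\<theta> $ i\<bar>) \<in> borel \<Otimes>\<^sub>M measure_pmf q \<rightarrow>\<^sub>M borel"
    proof -
      let ?P = "(borel :: (real ^ 'n) measure) \<Otimes>\<^sub>M measure_pmf q"
      \<comment> \<open>The index is discrete, so joint measurability reduces to measurability for
        each fixed index.\<close>
      have snd: "snd \<in> ?P \<rightarrow>\<^sub>M count_space UNIV"
        using measurable_snd[of borel "measure_pmf q"]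
        by (simp only: measurable_cong_sets[OF refl sets_measure_pmf_count_space])
      have "(\<lambda>p. ln \<bar>fst p $ i\<bar>) \<in> borel_measurable ?P" for i
        by (intro borel_measurable_ln borel_measurable_abs
            measurable_compose[OF measurable_fst borel_measurable_nth])
      from measurable_compose_countable[OF this snd] show ?thesis
        by (simp only: case_prod_beta')
    qed
  qed
  then show ?thesis
    unfolding decoded_measure_def[abs_def]
    by (rule measurable_compose_countable'[OF _ measurable_positive_coordinates]) auto
qed

lemma measurable_measure_power_decoded:
  assumes A: "A \<in> sets (borel :: (real ^ 'n) measure)"
  shows "(\<lambda>\<theta> :: real ^ 'n. measure (measure_power (decoded_measure \<theta>) :: (real ^ 'n) measure) A)
    \<in> borel_measurable borel"
proof -
  have "(\<lambda>\<theta> :: real ^ 'n. \<Sum>g\<in>UNIV. (\<Prod>i\<in>UNIV. pmf q (g i)) * indicator A (\<chi> i. ln \<bar>\<theta> $ g i\<bar>))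
      \<in> borel_measurable borel"
    for q :: "'n pmf"
    by (intro borel_measurable_sum borel_measurable_times
        measurable_compose[OF borel_measurable_vec_lambda borel_measurable_indicator[OF A]]) measurable
  then show ?thesis
    unfolding decoded_measure_def measure_power_distr_pmf[OF A]
    by (rule measurable_compose_countable'[OF _ measurable_positive_coordinates]) auto
qed

lemma prob_space_measure_power:
  assumes "prob_space \<pi>" "sets \<pi> = sets borel"
  shows "prob_space (measure_power \<pi> :: (real ^ 'n) measure)"
  unfolding measure_power_def
  by (intro prob_space.prob_space_distr prob_space_PiM measurable_vec_lambda_PiM assms)

theorem theorem2:
  fixes M :: "'a measure" and X :: "'a \<Rightarrow> real ^ 'n"
  assumes "prob_space M"
    and "X \<in> borel_measurable M"
    and "exchangeable M X"
  shows "\<exists>(\<eta> :: (real ^ 'n) set \<Rightarrow> real) (\<pi> :: real ^ 'n \<Rightarrow> real measure).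
           bounded_signed_measure borel \<eta> \<and>
           \<pi> \<in> borel \<rightarrow>\<^sub>M prob_algebra borel \<and>
           (\<forall>A \<in> sets borel.
              measure M {\<omega> \<in> space M. X \<omega> \<in> A} =
              signed_integral borel \<eta> (\<lambda>\<theta>. measure (measure_power (\<pi> \<theta>)) A))"
proof (intro exI conjI ballI)
  interpret prob_space M by fact
  note [measurable] = assms(2)
  \<comment> \<open>The polarization coefficients, normalized by the number of permutations.\<close>
  define c :: "'n set \<Rightarrow> real" where
    "c S = (-1) ^ (CARD('n) + card S) * real (card S) ^ CARD('n) / fact CARD('n)" for S
  define N where "N S = distr M borel (\<lambda>\<omega>. sign_encode S (X \<omega>))" for S
  have N: "finite_measure (N S)" "sets (N S) = sets borel" for S
    unfolding N_def by (auto intro!: finite_measure_distr)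
  define \<eta> where "\<eta> A = (\<Sum>S\<in>UNIV. c S * measure (N S) A)" for A
  show "bounded_signed_measure borel \<eta>"
    unfolding \<eta>_def[abs_def] using N by (intro bounded_signed_measure_sum)
  show m: "decoded_measure \<in> (borel :: (real ^ 'n) measure) \<rightarrow>\<^sub>M prob_algebra borel"
    by (rule measurable_decoded_measure)
  fix A :: "(real ^ 'n) set" assume A [measurable]: "A \<in> sets borel"
  define f where "f \<theta> = measure (measure_power (decoded_measure \<theta>) :: (real ^ 'n) measure) A"
    for \<theta> :: "real ^ 'n"
  have f [measurable]: "f \<in> borel_measurable borel"
    unfolding f_def[abs_def] using A by (rule measurable_measure_power_decoded)
  \<comment> \<open>The bounds hold at every \<theta>, encoding or not, as
    \<open>signed_integral_sum\<close> requires.\<close>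
  have f01: "0 \<le> f \<theta>" "f \<theta> \<le> 1" for \<theta>
    using measurable_space[OF m, of \<theta>]
    by (auto simp: f_def space_prob_algebra intro!: prob_space.prob_le_1 prob_space_measure_power)
  have int: "integrable M (\<lambda>\<omega>. f (sign_encode S (X \<omega>)))" for S
    by (intro integrable_const_bound[where B = 1]) (auto simp: f01)
  \<comment> \<open>Decoding turns polarization into an identity for each fixed
    \<open>x\<close>.\<close>
  have polar: "(\<Sum>S\<in>UNIV. c S * f (sign_encode S x)) =
      (\<Sum>\<sigma> | \<sigma> permutes UNIV. indicator A (\<chi> i. x $ \<sigma> i)) / fact CARD('n)" for x
    unfolding c_def f_def decoded_measure_sign_encode polarization_measure_power[OF A, symmetric]
    by (simp add: sum_divide_distrib)
  \<comment> \<open>Exchangeability enters here: every permuted indicator has the same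
    expectation.\<close>
  have perm: "(\<integral>\<omega>. indicator A (\<chi> i. X \<omega> $ \<sigma> i) \<partial>M) = prob {\<omega> \<in> space M. X \<omega> \<in> A}"
    if \<sigma>: "\<sigma> permutes UNIV" for \<sigma>
  proof -
    have "(\<integral>\<omega>. indicator A (\<chi> i. X \<omega> $ \<sigma> i) \<partial>M) =
        (\<integral>\<omega>. indicator {\<omega> \<in> space M. (\<chi> i. X \<omega> $ \<sigma> i) \<in> A} \<omega> \<partial>M :: real)"
      by (intro Bochner_Integration.integral_cong) (auto simp: indicator_def)
    also have "\<dots> = prob {\<omega> \<in> space M. (\<chi> i. X \<omega> $ \<sigma> i) \<in> A}"
      by (simp add: Int_absorb2)
    also have "\<dots> = prob {\<omega> \<in> space M. X \<omega> \<in> A}"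
      using assms(3) \<sigma> A by (simp add: exchangeable_def)
    finally show ?thesis .
  qed
  have Xp: "(\<lambda>\<omega>. \<chi> i. X \<omega> $ \<sigma> i) \<in> borel_measurable M" for \<sigma>
    by (intro borel_measurable_vec_lambda measurable_compose[OF assms(2)] borel_measurable_nth)
  have "signed_integral borel \<eta> f = (\<Sum>S\<in>UNIV. c S * integral\<^sup>L (N S) f)"
    unfolding \<eta>_def[abs_def] using N f01 by (intro signed_integral_sum) auto
  also have "\<dots> = (\<Sum>S\<in>UNIV. c S * (\<integral>\<omega>. f (sign_encode S (X \<omega>)) \<partial>M))"
    unfolding N_def by (simp add: integral_distr)
  \<comment> \<open>With the finite sum under one integral, \<open>polar\<close> applies for each
    outcome.\<close>
  also have "\<dots> = (\<integral>\<omega>. (\<Sum>S\<in>UNIV. c S * f (sign_encode S (X \<omega>))) \<partial>M)"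
    using int by simp
  also have "\<dots> = (\<Sum>\<sigma> | \<sigma> permutes (UNIV :: 'n set).
      \<integral>\<omega>. indicator A (\<chi> i. X \<omega> $ \<sigma> i) \<partial>M) / fact CARD('n)"
    unfolding polar
    by (simp, subst Bochner_Integration.integral_sum)
       (auto intro!: integrable_const_bound[where B = 1]
          measurable_compose[OF Xp borel_measurable_indicator])
  \<comment> \<open>The equal terms, one for each permutation, cancel the factorial.\<close>
  also have "\<dots> = prob {\<omega> \<in> space M. X \<omega> \<in> A}"
    by (simp add: perm card_permutations)
  finally show "prob {\<omega> \<in> space M. X \<omega> \<in> A} =
      signed_integral borel \<eta> (\<lambda>\<theta>. measure (measure_power (decoded_measure \<theta>)) A)"
    unfolding f_def[abs_def] by simp
qed

end
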